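(* Let $n\ge 2$, let $L\subset\mathbb R^n$ be a convex body with $0\in\operatorname{int}L$, let $\phi:[0,\infty)\to[0,\infty)$ be nondecreasing, nonconstant, and convex, and assume that $\int_{\mathbb R^n}e^{-\phi(\|x\|_L)}\,dx=1$. Let $\mu$ be the probability measure on $\mathbb R^n$ with $d\mu(x)=e^{-\phi(\|x\|_L)}\,dx$. Let $K,M\subset\mathbb R^n$ be convex bodies containing the origin in their interiors. Suppose that there exists $R>0$ such that \[ \mu(tRL;M)\ge\mu(tK;M)\qquad\text{for all sufficiently large }t. \] Then $RL\subseteq K$.
   Context: A convex body is a compact convex subset of $\mathbb R^n$ with nonempty interior. For a convex body $L$ with $0\in\operatorname{int}L$, the gauge is $\|x\|_L=\inf\{\lambda\ge0:x\in\lambda L\}$. For a Borel measure $\mu$ on $\mathbb R^n$ and Borel sets $K,M\subset\mathbb R^n$, the mixed measure is \[ \mu(K;M)=\liminf_{\varepsilon\to0^+}\frac{\mu(K+\varepsilon M)-\mu(K)}{\varepsilon}, \] where $A+B=\{a+b:a\in A,\ b\in B\}$ and $\alpha A=\{\alpha x:x\in A\}$. *)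

theory Defs
  imports "HOL-Analysis.Analysis" "HOL-Library.Set_Algebras"
begin

definition convex_body :: "'a::euclidean_space set \<Rightarrow> bool" where
  "convex_body L \<longleftrightarrow> compact L \<and> convex L \<and> interior L \<noteq> {}"

definition gauge_norm :: "'a::euclidean_space set \<Rightarrow> 'a \<Rightarrow> real" where
  "gauge_norm L x = Inf {l. 0 \<le> l \<and> x \<in> (*\<^sub>R) l ` L}"

(* The addition of sets is the Minkowski sum of HOL-Library.Set_Algebras.
   The liminf is taken in the extended reals, so that no finiteness of it is presupposed. *)
definition mixed_measure ::
  "'a::euclidean_space measure \<Rightarrow> 'a set \<Rightarrow> 'a set \<Rightarrow> ereal" where
  "mixed_measure \<mu> K M =
     Liminf (at_right 0)
       (\<lambda>\<epsilon>::real. (enn2ereal (emeasure \<mu> (K + (*\<^sub>R) \<epsilon> ` M)) - enn2ereal (emeasure \<mu> K)) / ereal \<epsilon>)"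

definition gauge_measure ::
  "(real \<Rightarrow> real) \<Rightarrow> 'a::euclidean_space set \<Rightarrow> 'a measure" where
  "gauge_measure \<phi> L = density lborel (\<lambda>x. ennreal (exp (- \<phi> (gauge_norm L x))))"

end

theory Submission
  imports Defs "HOL-Real_Asymp.Real_Asymp"
begin

text \<open>
  If \<open>R L\<close> is not contained in \<open>K\<close>, then for some \<open>r < R\<close> a nonempty open subset \<open>U\<close> of \<open>r L\<close>
  misses \<open>K\<close>. Let \<open>D\<close> be the part of \<open>K\<close> in the cone over \<open>U\<close>; then \<open>t D\<close> lies in \<open>r t L\<close>.
  Enclosing \<open>M\<close> between a small multiple \<open>d K\<close> and a large multiple \<open>c L\<close> reduces the Minkowski
  sums to dilations, so that \<open>\<mu>(tRL; M)\<close> is at most a constant times \<open>t^(n-1) exp (-\<phi>(tR))\<close>, while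
  \<open>\<mu>(tK; M)\<close>, bounded below by the shells of \<open>D\<close> alone, is at least a constant times
  \<open>t^(n-1) exp (-\<phi>(r(t+d)))\<close>. By convexity \<open>\<phi>(tR) - \<phi>(r(t+d))\<close> grows linearly in \<open>t\<close>,
  contradicting the comparison of the two mixed measures.
\<close>

section \<open>Powers, and Minkowski sums and inclusions of dilates\<close>

text \<open>Mean value bounds with the derivative taken at either endpoint. They turn the volume of
  a shell between two dilates into its thickness times a factor of order n - 1 in the scale.\<close>

lemma power_diff_bounds:
  fixes s t :: real
  assumes "0 \<le> s" "s \<le> t"
  shows "real n * s ^ (n - 1) * (t - s) \<le> t ^ n - s ^ n"
    and "t ^ n - s ^ n \<le> real n * t ^ (n - 1) * (t - s)"
proof (induction n)
  case (Suc n)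
  have eq: "t ^ Suc n - s ^ Suc n = t * (t ^ n - s ^ n) + s ^ n * (t - s)"
    by (simp add: algebra_simps)
  have pn: "r * (real n * r ^ (n - 1)) = real n * r ^ n" for r :: real
    by (cases n) auto
  {
    case 1
    have "real n * s ^ n * (t - s) = s * (real n * s ^ (n - 1) * (t - s))"
      by (subst pn[of s, symmetric]) (simp add: mult_ac)
    also have "\<dots> \<le> s * (t ^ n - s ^ n)"
      using Suc.IH(1) assms by (intro mult_left_mono)
    also have "\<dots> \<le> t * (t ^ n - s ^ n)"
      using assms by (intro mult_right_mono) (auto simp: power_mono)
    finally show ?case
      unfolding eq by (simp add: algebra_simps)
  next
    case 2
    have "t * (t ^ n - s ^ n) \<le> t * (real n * t ^ (n - 1) * (t - s))"
      using Suc.IH(2) assms by (intro mult_left_mono) auto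
    also have "\<dots> = real n * t ^ n * (t - s)"
      by (subst pn[of t, symmetric]) (simp add: mult_ac)
    finally have "t * (t ^ n - s ^ n) \<le> real n * t ^ n * (t - s)" .
    moreover have "s ^ n * (t - s) \<le> t ^ n * (t - s)"
      using assms by (intro mult_right_mono power_mono) auto
    ultimately show ?case
      unfolding eq by (simp add: algebra_simps)
  }
qed auto

lemma scaleR_image_subset:
  assumes "convex L" "0 \<in> L" "0 \<le> s" "s \<le> t"
  shows "(*\<^sub>R) s ` L \<subseteq> (*\<^sub>R) t ` L"
proof (cases "t = 0")
  case False
  show ?thesis
  proof clarify
    fix x assume "x \<in> L"
    have "(s / t) *\<^sub>R x + (1 - s / t) *\<^sub>R 0 \<in> L"
      using assms False \<open>x \<in> L\<close> by (intro convexD) auto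
    then show "s *\<^sub>R x \<in> (*\<^sub>R) t ` L"
      using False by (intro image_eqI[of _ _ "(s / t) *\<^sub>R x"]) auto
  qed
qed (use assms in auto)

text \<open>Convexity enters in the inclusion from left to right: s a + t b is s + t times a convex
  combination of a and b. This is what reduces Minkowski sums to dilations.\<close>

lemma scaleR_image_add:
  assumes "convex K" "0 \<le> s" "0 \<le> t"
  shows "(*\<^sub>R) s ` K + (*\<^sub>R) t ` K = (*\<^sub>R) (s + t) ` K"
proof (cases "s + t = 0")
  case True
  then have "s = 0" "t = 0"
    using assms by auto
  then show ?thesis
    by (auto simp: set_plus_def image_iff)
next
  case False
  show ?thesis
  proof (intro subset_antisym subsetI)
    fix x assume "x \<in> (*\<^sub>R) s ` K + (*\<^sub>R) t ` K"
    then obtain a b where ab: "a \<in> K" "b \<in> K" "x = s *\<^sub>R a + t *\<^sub>R b"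
      by (auto simp: set_plus_def)
    have "(s / (s + t)) *\<^sub>R a + (t / (s + t)) *\<^sub>R b \<in> K"
      using assms False ab by (intro convexD) (auto simp flip: add_divide_distrib)
    moreover have "x = (s + t) *\<^sub>R ((s / (s + t)) *\<^sub>R a + (t / (s + t)) *\<^sub>R b)"
      using False ab by (simp add: scaleR_add_right)
    ultimately show "x \<in> (*\<^sub>R) (s + t) ` K"
      by blast
  next
    fix x assume "x \<in> (*\<^sub>R) (s + t) ` K"
    then show "x \<in> (*\<^sub>R) s ` K + (*\<^sub>R) t ` K"
      by (auto simp: scaleR_add_left intro!: set_plus_intro)
  qed
qed

text \<open>Some ball of radius \<open>e\<close> about 0 lies in \<open>L\<close>; blown up by
  \<open>B / e\<close> it becomes the ball of radius \<open>B\<close>, which already contains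
  \<open>A\<close>.\<close>

lemma bounded_subset_scaleR_image:
  fixes L :: "'a::euclidean_space set"
  assumes "0 \<in> interior L" "bounded A"
  obtains c where "c > 0" "A \<subseteq> (*\<^sub>R) c ` L"
proof -
  obtain e where e: "e > 0" "cball 0 e \<subseteq> L"
    using assms(1) mem_interior_cball by blast
  obtain B where B: "B > 0" "\<And>x. x \<in> A \<Longrightarrow> norm x \<le> B"
    using assms(2) bounded_pos by blast
  have "A \<subseteq> (*\<^sub>R) (B / e) ` L"
  proof
    fix x assume "x \<in> A"
    then have "(e / B) *\<^sub>R x \<in> cball 0 e"
      using B(1) B(2)[of x] e(1) by (simp add: field_simps)
    then have "(e / B) *\<^sub>R x \<in> L"
      using e by blast
    then show "x \<in> (*\<^sub>R) (B / e) ` L"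
      using e(1) B(1) by (intro image_eqI[of _ _ "(e / B) *\<^sub>R x"]) auto
  qed
  then show thesis
    using that[of "B / e"] e(1) B(1) by simp
qed

lemma interior_absorbs:
  fixes L :: "'a::euclidean_space set"
  assumes "0 \<in> interior L"
  obtains c where "c > 0" "x \<in> (*\<^sub>R) c ` L"
  using bounded_subset_scaleR_image[OF assms, of "{x}"] by auto

section \<open>The gauge of a body\<close>

lemma gauge_norm_le: "gauge_norm L x \<le> l" if "0 \<le> l" "x \<in> (*\<^sub>R) l ` L"
  unfolding gauge_norm_def using that by (intro cInf_lower) (auto intro: bdd_belowI)

lemma gauge_norm_ge:
  fixes L :: "'a::euclidean_space set"
  assumes "convex L" "0 \<in> interior L" "0 \<le> s" "x \<notin> (*\<^sub>R) s ` L"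
  shows "s \<le> gauge_norm L x"
  unfolding gauge_norm_def
proof (intro cInf_greatest)
  show "{l. 0 \<le> l \<and> x \<in> (*\<^sub>R) l ` L} \<noteq> {}"
    using interior_absorbs[OF assms(2), of x] by (metis (mono_tags, lifting) empty_iff less_imp_le mem_Collect_eq)
  fix l assume l: "l \<in> {l. 0 \<le> l \<and> x \<in> (*\<^sub>R) l ` L}"
  show "s \<le> l"
  proof (rule ccontr)
    assume "\<not> s \<le> l"
    then have "(*\<^sub>R) l ` L \<subseteq> (*\<^sub>R) s ` L"
      using l assms interior_subset by (intro scaleR_image_subset) auto
    then show False
      using l assms(4) by auto
  qed
qed

lemma gauge_norm_nonneg:
  fixes L :: "'a::euclidean_space set"
  assumes "0 \<in> interior L"
  shows "0 \<le> gauge_norm L x"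
  unfolding gauge_norm_def
  using interior_absorbs[OF assms, of x]
  by (intro cInf_greatest) (auto, metis less_imp_le imageI)

section \<open>Lebesgue measure of dilates and shells\<close>

lemma borel_scaleR_image:
  fixes A :: "'a::euclidean_space set"
  assumes "A \<in> sets borel" "c > 0"
  shows "(*\<^sub>R) c ` A \<in> sets borel"
proof -
  have "(*\<^sub>R) c ` A = (*\<^sub>R) (1 / c) -` A \<inter> space borel"
    using assms(2) by (auto simp: image_iff intro!: bexI[of _ "(1 / c) *\<^sub>R _"])
  also have "\<dots> \<in> sets borel"
    using assms(1) by (intro measurable_sets[of _ borel borel]) auto
  finally show ?thesis .
qed

lemma measure_lborel_scaleR_image:
  fixes A :: "'a::euclidean_space set"
  assumes "A \<in> sets borel" "c > 0"
  shows "measure lborel ((*\<^sub>R) c ` A) = c ^ DIM('a) * measure lborel A"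
  using measure_lebesgue_affine[of c "0::'a" A] assms borel_scaleR_image[OF assms]
  by (simp add: measure_completion)

lemma fmeasurable_lborel_bounded:
  fixes A :: "'a::euclidean_space set"
  assumes "A \<in> sets borel" "bounded A"
  shows "A \<in> fmeasurable lborel"
  using assms emeasure_bounded_finite by (intro fmeasurableI) auto

text \<open>Nestedness is a hypothesis rather than a consequence of convexity because the lemma also
  serves the section of \<open>K\<close> by a cone, which need not be convex.\<close>

lemma measure_lborel_shell:
  fixes A :: "'a::euclidean_space set"
  assumes "A \<in> sets borel" "bounded A" "0 < s" "s \<le> t" "(*\<^sub>R) s ` A \<subseteq> (*\<^sub>R) t ` A"
  shows "measure lborel ((*\<^sub>R) t ` A - (*\<^sub>R) s ` A) = (t ^ DIM('a) - s ^ DIM('a)) * measure lborel A"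
proof -
  have "measure lborel ((*\<^sub>R) t ` A - (*\<^sub>R) s ` A)
      = measure lborel ((*\<^sub>R) t ` A) - measure lborel ((*\<^sub>R) s ` A)"
    using assms fmeasurable_lborel_bounded[of "(*\<^sub>R) t ` A"]
    by (intro measure_Diff) (auto simp: borel_scaleR_image bounded_scaling fmeasurable_def)
  then show ?thesis
    using assms by (simp add: measure_lborel_scaleR_image left_diff_distrib)
qed

section \<open>Locating a part of K where the gauge of L is small\<close>

text \<open>The cone \<open>C\<close> over \<open>U\<close> is invariant under positive dilations,
  so t D is the intersection of \<open>C\<close> with t K. Both shell inclusions follow from this.
  The last property records that each ray through \<open>U\<close> leaves \<open>K\<close> before it
  reaches \<open>U\<close>.\<close>

lemma cone_section:
  fixes K U :: "'a::euclidean_space set"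
  assumes "compact K" "convex K" "0 \<in> interior K" "open U" "U \<noteq> {}" "U \<inter> K = {}"
  obtains D where "D \<in> sets borel" "bounded D" "measure lborel D > 0"
    "\<And>s t. 0 < s \<Longrightarrow> s \<le> t \<Longrightarrow> (*\<^sub>R) s ` D \<subseteq> (*\<^sub>R) t ` D"
    "\<And>s t. 0 < s \<Longrightarrow> s \<le> t \<Longrightarrow> (*\<^sub>R) t ` D - (*\<^sub>R) s ` D \<subseteq> (*\<^sub>R) t ` K - (*\<^sub>R) s ` K"
    "\<And>t x. 0 < t \<Longrightarrow> x \<in> (*\<^sub>R) t ` D \<Longrightarrow> \<exists>l. 0 < l \<and> l < t \<and> x \<in> (*\<^sub>R) l ` U"
proof -
  define C where "C = (\<Union>s\<in>{0<..}. (*\<^sub>R) s ` U)"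
  define D where "D = C \<inter> K"
  have K0: "0 \<in> K"
    using assms(3) interior_subset by blast
  have C_open: "open C"
    unfolding C_def using assms(4) by (intro open_UN ballI open_scaling) auto
  have C_cone: "(*\<^sub>R) t ` C = C" if "t > 0" for t
  proof (intro subset_antisym subsetI)
    fix x assume "x \<in> (*\<^sub>R) t ` C"
    then obtain s u where "s > 0" "u \<in> U" "x = (t * s) *\<^sub>R u"
      unfolding C_def by auto
    then show "x \<in> C"
      unfolding C_def using that by (intro UN_I[of "t * s"]) auto
  next
    fix x assume "x \<in> C"
    then obtain s u where su: "s > 0" "u \<in> U" "x = s *\<^sub>R u"
      unfolding C_def by auto
    then have "(s / t) *\<^sub>R u \<in> C"
      unfolding C_def using that by (intro UN_I[of "s / t"]) auto
    then show "x \<in> (*\<^sub>R) t ` C"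
      using that su by (intro image_eqI[of _ _ "(s / t) *\<^sub>R u"]) auto
  qed
  have D_scale: "(*\<^sub>R) t ` D = C \<inter> (*\<^sub>R) t ` K" if "t > 0" for t
  proof -
    have "inj ((*\<^sub>R) t :: 'a \<Rightarrow> 'a)"
      using that by (auto simp: inj_on_def)
    then have "(*\<^sub>R) t ` D = (*\<^sub>R) t ` C \<inter> (*\<^sub>R) t ` K"
      unfolding D_def by (rule image_Int)
    then show ?thesis
      using C_cone[OF that] by simp
  qed
  have borel: "D \<in> sets borel"
    unfolding D_def using C_open assms(1) by (intro sets.Int borel_open borel_compact)
  have bdd: "bounded D"
    unfolding D_def using assms(1) compact_imp_bounded by blast
  have pos: "measure lborel D > 0"
  proof -
    obtain u where u: "u \<in> U"
      using assms(5) by blast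
    \<comment> \<open>The ray through \<open>u\<close> meets the interior of \<open>K\<close> near
      the origin, so \<open>D\<close> contains a nonempty open set.\<close>
    obtain c where c: "c > 0" "u \<in> (*\<^sub>R) c ` interior K"
      using interior_absorbs[of "interior K" u] assms(3) by auto
    then obtain k where k: "k \<in> interior K" "u = c *\<^sub>R k"
      by auto
    then have "k \<in> C"
      unfolding C_def using c u by (intro UN_I[of "1 / c"] image_eqI[of _ _ u]) auto
    with k have "C \<inter> interior K \<noteq> {}"
      by blast
    then have "emeasure lborel (C \<inter> interior K) \<noteq> 0"
      using C_open open_not_negligible[of "C \<inter> interior K"]
      by (auto simp: negligible_iff_null_sets null_sets_def)
    moreover have "emeasure lborel (C \<inter> interior K) \<le> emeasure lborel D"
      using borel interior_subset unfolding D_def by (intro emeasure_mono) auto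
    ultimately have "emeasure lborel D \<noteq> 0"
      by auto
    then show ?thesis
      using fmeasurable_lborel_bounded[OF borel bdd]
      by (metis emeasure_eq_measure2 ennreal_0 zero_less_measure_iff)
  qed
  show thesis
  proof (rule that[OF borel bdd pos])
    fix s t :: real assume st: "0 < s" "s \<le> t"
    show "(*\<^sub>R) s ` D \<subseteq> (*\<^sub>R) t ` D"
      using scaleR_image_subset[OF assms(2) K0, of s t] st by (auto simp: D_scale)
    show "(*\<^sub>R) t ` D - (*\<^sub>R) s ` D \<subseteq> (*\<^sub>R) t ` K - (*\<^sub>R) s ` K"
      using st by (auto simp: D_scale)
  next
    fix t :: real and x assume t: "0 < t" and x: "x \<in> (*\<^sub>R) t ` D"
    from x t have "x \<in> C" and xK: "x \<in> (*\<^sub>R) t ` K"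
      by (auto simp: D_scale)
    then obtain l u where l: "l > 0" "u \<in> U" "x = l *\<^sub>R u"
      unfolding C_def by auto
    \<comment> \<open>If t were at most l, then x = l u would lie in l K, which puts u into both
      \<open>U\<close> and \<open>K\<close>.\<close>
    have "l < t"
    proof (rule ccontr)
      assume "\<not> l < t"
      then have "x \<in> (*\<^sub>R) l ` K"
        using scaleR_image_subset[OF assms(2) K0, of t l] t xK by auto
      then have "u \<in> K"
        using l by auto
      with l assms(6) show False
        by blast
    qed
    with l show "\<exists>l. 0 < l \<and> l < t \<and> x \<in> (*\<^sub>R) l ` U"
      by auto
  qed
qed

text \<open>A point R x outside the closed set \<open>K\<close> stays outside when R is lowered
  slightly to r. The point r x may lie on the boundary of r L, but it is a limit of interior points
  because L is convex with nonempty interior; hence the open complement of \<open>K\<close> meets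
  that interior.\<close>

lemma open_outside_of_not_subset:
  fixes L K :: "'a::euclidean_space set"
  assumes "compact L" "convex L" "0 \<in> interior L" "closed K" "R > 0"
    and "\<not> (*\<^sub>R) R ` L \<subseteq> K"
  obtains r U where "0 < r" "r < R" "open U" "U \<noteq> {}" "U \<inter> K = {}" "U \<subseteq> (*\<^sub>R) r ` L"
proof -
  obtain x where x: "x \<in> L" "R *\<^sub>R x \<notin> K"
    using assms(6) by auto
  have "((\<lambda>r. r *\<^sub>R x) \<longlongrightarrow> R *\<^sub>R x) (at_left R)"
    by (intro tendsto_intros)
  then have "\<forall>\<^sub>F r in at_left R. r *\<^sub>R x \<in> - K"
    using assms(4) x by (intro topological_tendstoD) auto
  moreover have "\<forall>\<^sub>F r in at_left R. r \<in> {0<..<R}"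
    using eventually_at_left_real[OF assms(5)] .
  ultimately have "\<forall>\<^sub>F r in at_left R. r *\<^sub>R x \<in> - K \<and> r \<in> {0<..<R}"
    by eventually_elim auto
  then obtain r where r: "r *\<^sub>R x \<notin> K" "0 < r" "r < R"
    by (metis (mono_tags, lifting) ComplD eventually_happens greaterThanLessThan_iff trivial_limit_at_left_real)
  have "convex ((*\<^sub>R) r ` L)"
    using assms(2) by (rule convex_scaling)
  moreover have i: "interior ((*\<^sub>R) r ` L) = (*\<^sub>R) r ` interior L"
    using r by (intro interior_injective_linear_image) (auto simp: inj_on_def)
  ultimately have "closure (interior ((*\<^sub>R) r ` L)) = closure ((*\<^sub>R) r ` L)"
    using assms(3) by (intro convex_closure_interior) auto
  then have "r *\<^sub>R x \<in> closure (interior ((*\<^sub>R) r ` L))"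
    using x(1) closure_subset[of "(*\<^sub>R) r ` L"] by auto
  then have "- K \<inter> interior ((*\<^sub>R) r ` L) \<noteq> {}"
    using assms(4) r(1) by (subst open_Int_closure_eq_empty[symmetric]) auto
  then show thesis
    using r assms(4) interior_subset[of "(*\<^sub>R) r ` L"]
    by (intro that[of r "- K \<inter> interior ((*\<^sub>R) r ` L)"]) (auto simp: open_Compl)
qed

section \<open>Linear growth of \<phi>\<close>

text \<open>The rate \<open>m\<close> is the slope of the chord from 0 to a point \<open>b\<close>
  where \<phi> exceeds \<phi> 0. By convexity, chords farther to the right are at least as
  steep.\<close>

lemma convex_mono_linear_growth:
  fixes \<phi> :: "real \<Rightarrow> real"
  assumes "mono_on {0..} \<phi>" "\<not> \<phi> constant_on {0..}" "convex_on {0..} \<phi>"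
  obtains m b where "m > 0" "b \<ge> 0" "\<And>u v. b \<le> u \<Longrightarrow> u \<le> v \<Longrightarrow> m * (v - u) \<le> \<phi> v - \<phi> u"
proof -
  obtain b where b: "b \<ge> 0" "\<phi> b \<noteq> \<phi> 0"
    using assms(2) unfolding constant_on_def by auto
  then have b0: "b > 0"
    by (cases "b = 0") auto
  have lt: "\<phi> 0 < \<phi> b"
    using b mono_onD[OF assms(1), of 0 b] by auto
  define m where "m = (\<phi> b - \<phi> 0) / b"
  have "m * (v - u) \<le> \<phi> v - \<phi> u" if uv: "b \<le> u" "u \<le> v" for u v
  proof (cases "u = v")
    case False
    then have "u < v"
      using uv by simp
    have 1: "m \<le> (\<phi> u - \<phi> 0) / u"
    proof (cases "u = b")
      case False
      then show ?thesis
        using convex_on_slope_le(1)[OF assms(3), of 0 u b] b0 uv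
        by (simp add: m_def field_simps)
    qed (simp add: m_def)
    have "(\<phi> u - \<phi> 0) / u \<le> (\<phi> v - \<phi> 0) / v"
      using convex_on_slope_le(1)[OF assms(3), of 0 v u] b0 uv \<open>u < v\<close>
      by (simp add: field_simps)
    \<comment> \<open>The chord inequality is stated with differences taken towards v; flipping the
      signs of numerator and denominator gives this form.\<close>
    also have "\<dots> \<le> (\<phi> v - \<phi> u) / (v - u)"
      using convex_on_slope_le(2)[OF assms(3), of 0 v u] b0 uv \<open>u < v\<close>
        minus_divide_divide[of "\<phi> u - \<phi> v" "u - v"] minus_divide_divide[of "\<phi> 0 - \<phi> v" "0 - v"]
      by simp
    finally have "m \<le> (\<phi> v - \<phi> u) / (v - u)"
      using 1 by linarith
    then show ?thesis
      using \<open>u < v\<close> by (simp add: le_divide_eq)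
  qed simp
  then show thesis
    using that[of m b] lt b0 by (simp add: m_def)
qed

section \<open>Estimates for the gauge measure\<close>

lemma compact_plus_scaleR:
  fixes A M :: "'a::euclidean_space set"
  assumes "compact A" "compact M"
  shows "compact (A + (*\<^sub>R) c ` M)"
proof -
  have "A + (*\<^sub>R) c ` M = {x + y | x y. x \<in> A \<and> y \<in> (*\<^sub>R) c ` M}"
    by (auto simp: set_plus_def)
  then show ?thesis
    using compact_sums[OF assms(1) compact_scaling[OF assms(2), of c]] by simp
qed

text \<open>Integrability of the density also supplies its measurability, so the gauge itself is
  never shown to be measurable.\<close>

lemma emeasure_gauge_measure:
  fixes L :: "'a::euclidean_space set"
  assumes "integrable lborel (\<lambda>x. exp (- \<phi> (gauge_norm L x)))" "A \<in> sets borel"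
  shows "emeasure (gauge_measure \<phi> L) A
    = ennreal (\<integral>x. indicator A x * exp (- \<phi> (gauge_norm L x)) \<partial>lborel)"
proof -
  have "(\<lambda>x. exp (- \<phi> (gauge_norm L x))) \<in> borel_measurable lborel"
    using assms(1) by (rule borel_measurable_integrable)
  then have "emeasure (gauge_measure \<phi> L) A
    = (\<integral>\<^sup>+x. ennreal (exp (- \<phi> (gauge_norm L x))) * indicator A x \<partial>lborel)"
    unfolding gauge_measure_def using assms(2) by (intro emeasure_density) auto
  also have "\<dots> = (\<integral>\<^sup>+x. ennreal (indicator A x * exp (- \<phi> (gauge_norm L x))) \<partial>lborel)"
    by (intro nn_integral_cong) (auto split: split_indicator)
  also have "\<dots> = ennreal (\<integral>x. indicator A x * exp (- \<phi> (gauge_norm L x)) \<partial>lborel)"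
    using integrable_mult_indicator[OF _ assms(1), of A] assms(2)
    by (intro nn_integral_eq_integral) auto
  finally show ?thesis .
qed

lemma measure_gauge_measure:
  fixes L :: "'a::euclidean_space set"
  assumes "integrable lborel (\<lambda>x. exp (- \<phi> (gauge_norm L x)))" "A \<in> sets borel"
  shows "measure (gauge_measure \<phi> L) A
    = (\<integral>x. indicator A x * exp (- \<phi> (gauge_norm L x)) \<partial>lborel)"
  unfolding measure_def emeasure_gauge_measure[OF assms] by (simp add: integral_nonneg)

lemma finite_measure_gauge_measure:
  fixes L :: "'a::euclidean_space set"
  assumes "integrable lborel (\<lambda>x. exp (- \<phi> (gauge_norm L x)))"
  shows "finite_measure (gauge_measure \<phi> L)"
  using emeasure_gauge_measure[OF assms, of UNIV]
  by (intro finite_measureI) (simp add: gauge_measure_def)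

lemma measure_gauge_measure_le:
  fixes L A :: "'a::euclidean_space set"
  assumes "integrable lborel (\<lambda>x. exp (- \<phi> (gauge_norm L x)))"
    and "mono_on {0..} \<phi>" "A \<in> sets borel" "bounded A" "0 \<le> s"
    and "\<And>x. x \<in> A \<Longrightarrow> s \<le> gauge_norm L x"
  shows "measure (gauge_measure \<phi> L) A \<le> exp (- \<phi> s) * measure lborel A"
proof -
  have A: "A \<in> fmeasurable lborel"
    using assms(3,4) by (rule fmeasurable_lborel_bounded)
  have "measure (gauge_measure \<phi> L) A \<le> (\<integral>x. indicator A x * exp (- \<phi> s) \<partial>lborel)"
    unfolding measure_gauge_measure[OF assms(1,3)]
  proof (rule integral_mono)
    fix x
    show "indicator A x * exp (- \<phi> (gauge_norm L x)) \<le> indicator A x * exp (- \<phi> s)"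
      using mono_onD[OF assms(2), of s "gauge_norm L x"] assms(5) assms(6)[of x]
      by (auto split: split_indicator)
  qed (use integrable_mult_indicator[OF _ assms(1), of A] A in
        \<open>auto simp: fmeasurable_def\<close>)
  also have "\<dots> = exp (- \<phi> s) * measure lborel A"
    using A by (simp add: mult.commute)
  finally show ?thesis .
qed

text \<open>On \<open>A\<close> the density is at least its value at gauge \<open>s\<close>.
  Nonnegativity of the gauge, from 0 being interior to \<open>L\<close>, places the arguments where
  \<phi> is known to be monotone.\<close>

lemma measure_gauge_measure_ge:
  fixes L A :: "'a::euclidean_space set"
  assumes "integrable lborel (\<lambda>x. exp (- \<phi> (gauge_norm L x)))"
    and "mono_on {0..} \<phi>" "A \<in> sets borel" "bounded A" "0 \<in> interior L"
    and "\<And>x. x \<in> A \<Longrightarrow> gauge_norm L x \<le> s"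
  shows "exp (- \<phi> s) * measure lborel A \<le> measure (gauge_measure \<phi> L) A"
proof -
  have A: "A \<in> fmeasurable lborel"
    using assms(3,4) by (rule fmeasurable_lborel_bounded)
  have "exp (- \<phi> s) * measure lborel A = (\<integral>x. indicator A x * exp (- \<phi> s) \<partial>lborel)"
    using A by (simp add: mult.commute)
  also have "\<dots> \<le> measure (gauge_measure \<phi> L) A"
    unfolding measure_gauge_measure[OF assms(1,3)]
  proof (rule integral_mono)
    fix x
    show "indicator A x * exp (- \<phi> s) \<le> indicator A x * exp (- \<phi> (gauge_norm L x))"
      using mono_onD[OF assms(2), of "gauge_norm L x" s] assms(6)[of x]
        gauge_norm_nonneg[OF assms(5), of x]
      by (auto split: split_indicator)
  qed (use integrable_mult_indicator[OF _ assms(1), of A] A in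
        \<open>auto simp: fmeasurable_def\<close>)
  finally show ?thesis .
qed

section \<open>Bounds for mixed measures\<close>

lemma mixed_measure_quotient:
  fixes \<mu> :: "'a::euclidean_space measure"
  assumes "finite_measure \<mu>" "A \<in> sets \<mu>" "B \<in> sets \<mu>" "B \<subseteq> A" "\<epsilon> > 0"
  shows "(enn2ereal (emeasure \<mu> A) - enn2ereal (emeasure \<mu> B)) / ereal \<epsilon>
    = ereal (measure \<mu> (A - B) / \<epsilon>)"
proof -
  interpret finite_measure \<mu> by fact
  show ?thesis
    using assms by (simp add: emeasure_eq_measure finite_measure_Diff enn2ereal_ennreal)
qed

text \<open>As 0 lies in \<open>M\<close>, the set \<open>A\<close> is contained in its enlargement,
  and the difference quotient is the measure of the added layer over \<epsilon>. Bounds for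
  \<epsilon> < 1 suffice for the lower limit at 0.\<close>

lemma mixed_measure_bounds:
  fixes \<mu> :: "'a::euclidean_space measure"
  assumes "finite_measure \<mu>" "sets \<mu> = sets borel" "compact A" "compact M" "0 \<in> M"
  shows "(\<And>\<epsilon>. 0 < \<epsilon> \<Longrightarrow> \<epsilon> < 1 \<Longrightarrow> measure \<mu> (A + (*\<^sub>R) \<epsilon> ` M - A) \<le> c * \<epsilon>)
      \<Longrightarrow> mixed_measure \<mu> A M \<le> ereal c"
    and "(\<And>\<epsilon>. 0 < \<epsilon> \<Longrightarrow> \<epsilon> < 1 \<Longrightarrow> c * \<epsilon> \<le> measure \<mu> (A + (*\<^sub>R) \<epsilon> ` M - A))
      \<Longrightarrow> ereal c \<le> mixed_measure \<mu> A M"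
proof -
  have small: "\<forall>\<^sub>F \<epsilon>::real in at_right 0. \<epsilon> \<in> {0<..<1}"
    by (intro eventually_at_right_real) simp
  have quot: "(enn2ereal (emeasure \<mu> (A + (*\<^sub>R) \<epsilon> ` M)) - enn2ereal (emeasure \<mu> A)) / ereal \<epsilon>
      = ereal (measure \<mu> (A + (*\<^sub>R) \<epsilon> ` M - A) / \<epsilon>)" if "\<epsilon> > 0" for \<epsilon>
  proof (rule mixed_measure_quotient[OF assms(1)])
    show "A + (*\<^sub>R) \<epsilon> ` M \<in> sets \<mu>" "A \<in> sets \<mu>"
      using assms compact_plus_scaleR[OF assms(3,4)] by (auto intro: borel_compact)
    show "A \<subseteq> A + (*\<^sub>R) \<epsilon> ` M"
    proof
      fix x assume "x \<in> A"
      then have "x + \<epsilon> *\<^sub>R 0 \<in> A + (*\<^sub>R) \<epsilon> ` M"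
        using assms(5) by (intro set_plus_intro imageI)
      then show "x \<in> A + (*\<^sub>R) \<epsilon> ` M"
        by simp
    qed
  qed (use that in auto)
  {
    assume le: "\<And>\<epsilon>. 0 < \<epsilon> \<Longrightarrow> \<epsilon> < 1 \<Longrightarrow> measure \<mu> (A + (*\<^sub>R) \<epsilon> ` M - A) \<le> c * \<epsilon>"
    have "mixed_measure \<mu> A M \<le> Liminf (at_right (0::real)) (\<lambda>_. ereal c)"
      unfolding mixed_measure_def
      by (intro Liminf_mono eventually_mono[OF small]) (auto simp: quot divide_le_eq le)
    then show "mixed_measure \<mu> A M \<le> ereal c"
      by (simp add: Liminf_const)
  next
    assume ge: "\<And>\<epsilon>. 0 < \<epsilon> \<Longrightarrow> \<epsilon> < 1 \<Longrightarrow> c * \<epsilon> \<le> measure \<mu> (A + (*\<^sub>R) \<epsilon> ` M - A)"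
    show "ereal c \<le> mixed_measure \<mu> A M"
      unfolding mixed_measure_def
      by (intro Liminf_bounded eventually_mono[OF small]) (auto simp: quot le_divide_eq ge)
  }
qed

text \<open>The layer added to s L lies in the shell between s L and (s + \<epsilon> c) L. There the
  gauge is at least \<open>s\<close>, so the density is at most exp (- \<phi> s).\<close>

lemma mixed_measure_gauge_body_le:
  fixes L M :: "'a::euclidean_space set"
  assumes int: "integrable lborel (\<lambda>x. exp (- \<phi> (gauge_norm L x)))"
    and mono: "mono_on {0..} \<phi>"
    and L: "compact L" "convex L" "0 \<in> interior L"
    and M: "compact M" "0 \<in> M" "M \<subseteq> (*\<^sub>R) c ` L" "c > 0"
    and s: "s > 0"
  shows "mixed_measure (gauge_measure \<phi> L) ((*\<^sub>R) s ` L) M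
    \<le> ereal (exp (- \<phi> s) * (real DIM('a) * (s + c) ^ (DIM('a) - 1) * c * measure lborel L))"
proof (rule mixed_measure_bounds(1))
  let ?n = "DIM('a)" and ?\<mu> = "gauge_measure \<phi> L"
  interpret finite_measure ?\<mu>
    using int by (rule finite_measure_gauge_measure)
  show "finite_measure ?\<mu>"
    using int by (rule finite_measure_gauge_measure)
  show sets: "sets ?\<mu> = sets borel"
    by (simp add: gauge_measure_def)
  show "compact ((*\<^sub>R) s ` L)"
    using L by (intro compact_scaling)
  fix \<epsilon> :: real assume \<epsilon>: "0 < \<epsilon>" "\<epsilon> < 1"
  let ?S = "(*\<^sub>R) (s + \<epsilon> * c) ` L - (*\<^sub>R) s ` L"
  have L_borel: "L \<in> sets borel"
    using L by (intro borel_compact)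
  have ec: "0 < \<epsilon> * c" "\<epsilon> * c \<le> c"
    using \<epsilon> M by auto
  have sub: "(*\<^sub>R) s ` L \<subseteq> (*\<^sub>R) (s + \<epsilon> * c) ` L"
    using L interior_subset s ec by (intro scaleR_image_subset) auto
  have S_borel: "?S \<in> sets borel"
    using L_borel s ec by (intro sets.Diff borel_scaleR_image) auto
  have "(*\<^sub>R) \<epsilon> ` M \<subseteq> (*\<^sub>R) (\<epsilon> * c) ` L"
    using M(3) by force
  then have "(*\<^sub>R) s ` L + (*\<^sub>R) \<epsilon> ` M \<subseteq> (*\<^sub>R) s ` L + (*\<^sub>R) (\<epsilon> * c) ` L"
    by (intro set_plus_mono2) auto
  also have "\<dots> = (*\<^sub>R) (s + \<epsilon> * c) ` L"
    using L s ec by (intro scaleR_image_add) auto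
  finally have "(*\<^sub>R) s ` L + (*\<^sub>R) \<epsilon> ` M - (*\<^sub>R) s ` L \<subseteq> ?S"
    by blast
  then have "measure ?\<mu> ((*\<^sub>R) s ` L + (*\<^sub>R) \<epsilon> ` M - (*\<^sub>R) s ` L) \<le> measure ?\<mu> ?S"
    using S_borel sets by (intro finite_measure_mono) auto
  also have "\<dots> \<le> exp (- \<phi> s) * measure lborel ?S"
  proof (rule measure_gauge_measure_le[OF int mono S_borel])
    show "bounded ?S"
      using L compact_imp_bounded by (intro bounded_diff bounded_scaling) auto
    show "s \<le> gauge_norm L x" if "x \<in> ?S" for x
      using L s that by (intro gauge_norm_ge) auto
  qed (use s in auto)
  also have "measure lborel ?S = ((s + \<epsilon> * c) ^ ?n - s ^ ?n) * measure lborel L"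
    using L_borel L s ec sub compact_imp_bounded by (intro measure_lborel_shell) auto
  also have "\<dots> \<le> (real ?n * (s + c) ^ (?n - 1) * (\<epsilon> * c)) * measure lborel L"
  proof (rule mult_right_mono)
    have "(s + \<epsilon> * c) ^ ?n - s ^ ?n \<le> real ?n * (s + \<epsilon> * c) ^ (?n - 1) * (\<epsilon> * c)"
      using power_diff_bounds(2)[of s "s + \<epsilon> * c" ?n] s ec by simp
    \<comment> \<open>\<epsilon> < 1 removes \<epsilon> from the power, leaving a bound linear in
      \<epsilon>.\<close>
    also have "\<dots> \<le> real ?n * (s + c) ^ (?n - 1) * (\<epsilon> * c)"
      using s ec by (intro mult_right_mono mult_left_mono power_mono) auto
    finally show "(s + \<epsilon> * c) ^ ?n - s ^ ?n \<le> real ?n * (s + c) ^ (?n - 1) * (\<epsilon> * c)" .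
  qed simp
  finally show "measure ?\<mu> ((*\<^sub>R) s ` L + (*\<^sub>R) \<epsilon> ` M - (*\<^sub>R) s ` L)
      \<le> exp (- \<phi> s) * (real ?n * (s + c) ^ (?n - 1) * c * measure lborel L) * \<epsilon>"
    by (simp add: algebra_simps)
qed (use M in auto)

text \<open>Only the shell of \<open>D\<close> is counted: it lies in the layer added to t K, and
  unlike the rest of that layer it has gauge at most r (t + d), which bounds the density from
  below.\<close>

lemma mixed_measure_gauge_ge:
  fixes L K M D :: "'a::euclidean_space set"
  assumes int: "integrable lborel (\<lambda>x. exp (- \<phi> (gauge_norm L x)))"
    and mono: "mono_on {0..} \<phi>"
    and L: "0 \<in> interior L"
    and K: "compact K" "convex K"
    and M: "compact M" "0 \<in> M" "(*\<^sub>R) d ` K \<subseteq> M" "d > 0"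
    and D: "D \<in> sets borel" "bounded D"
      "\<And>s t. 0 < s \<Longrightarrow> s \<le> t \<Longrightarrow> (*\<^sub>R) s ` D \<subseteq> (*\<^sub>R) t ` D"
      "\<And>s t. 0 < s \<Longrightarrow> s \<le> t \<Longrightarrow> (*\<^sub>R) t ` D - (*\<^sub>R) s ` D \<subseteq> (*\<^sub>R) t ` K - (*\<^sub>R) s ` K"
      "\<And>t x. 0 < t \<Longrightarrow> x \<in> (*\<^sub>R) t ` D \<Longrightarrow> gauge_norm L x \<le> r * t"
    and r: "r > 0" and t: "t > 0"
  shows "ereal (exp (- \<phi> (r * (t + d))) * (real DIM('a) * t ^ (DIM('a) - 1) * d * measure lborel D))
    \<le> mixed_measure (gauge_measure \<phi> L) ((*\<^sub>R) t ` K) M"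
proof (rule mixed_measure_bounds(2))
  let ?n = "DIM('a)" and ?\<mu> = "gauge_measure \<phi> L"
  interpret finite_measure ?\<mu>
    using int by (rule finite_measure_gauge_measure)
  show "finite_measure ?\<mu>"
    using int by (rule finite_measure_gauge_measure)
  show sets: "sets ?\<mu> = sets borel"
    by (simp add: gauge_measure_def)
  show tK: "compact ((*\<^sub>R) t ` K)"
    using K by (intro compact_scaling)
  fix \<epsilon> :: real assume \<epsilon>: "0 < \<epsilon>" "\<epsilon> < 1"
  let ?S = "(*\<^sub>R) (t + \<epsilon> * d) ` D - (*\<^sub>R) t ` D"
  have ed: "0 < \<epsilon> * d" "\<epsilon> * d \<le> d"
    using \<epsilon> M by auto
  have S_borel: "?S \<in> sets borel"
    using D t ed by (intro sets.Diff borel_scaleR_image) auto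
  have "real ?n * t ^ (?n - 1) * (\<epsilon> * d) * measure lborel D
      \<le> ((t + \<epsilon> * d) ^ ?n - t ^ ?n) * measure lborel D"
    using power_diff_bounds(1)[of t "t + \<epsilon> * d" ?n] t ed by (intro mult_right_mono) auto
  also have "\<dots> = measure lborel ?S"
    using D t ed by (intro measure_lborel_shell[symmetric]) auto
  finally have "exp (- \<phi> (r * (t + d))) * (real ?n * t ^ (?n - 1) * (\<epsilon> * d) * measure lborel D)
      \<le> exp (- \<phi> (r * (t + d))) * measure lborel ?S"
    by (intro mult_left_mono) auto
  also have "\<dots> \<le> measure ?\<mu> ?S"
  proof (rule measure_gauge_measure_ge[OF int mono S_borel _ L])
    show "bounded ?S"
      using D by (intro bounded_diff bounded_scaling) auto
    fix x assume "x \<in> ?S"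
    then have "gauge_norm L x \<le> r * (t + \<epsilon> * d)"
      using D(5)[of "t + \<epsilon> * d" x] t ed by simp
    also have "\<dots> \<le> r * (t + d)"
      using r ed by (intro mult_left_mono) auto
    finally show "gauge_norm L x \<le> r * (t + d)" .
  qed
  also have "\<dots> \<le> measure ?\<mu> ((*\<^sub>R) t ` K + (*\<^sub>R) \<epsilon> ` M - (*\<^sub>R) t ` K)"
  proof (rule finite_measure_mono)
    have "(*\<^sub>R) (\<epsilon> * d) ` K = (*\<^sub>R) \<epsilon> ` (*\<^sub>R) d ` K"
      by (simp add: image_image)
    also have "\<dots> \<subseteq> (*\<^sub>R) \<epsilon> ` M"
      using M(3) by (rule image_mono)
    finally have "(*\<^sub>R) t ` K + (*\<^sub>R) (\<epsilon> * d) ` K \<subseteq> (*\<^sub>R) t ` K + (*\<^sub>R) \<epsilon> ` M"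
      by (intro set_plus_mono2) auto
    moreover have "(*\<^sub>R) t ` K + (*\<^sub>R) (\<epsilon> * d) ` K = (*\<^sub>R) (t + \<epsilon> * d) ` K"
      using K t ed by (intro scaleR_image_add) auto
    moreover have "?S \<subseteq> (*\<^sub>R) (t + \<epsilon> * d) ` K - (*\<^sub>R) t ` K"
      using D(4) t ed by simp
    ultimately show "?S \<subseteq> (*\<^sub>R) t ` K + (*\<^sub>R) \<epsilon> ` M - (*\<^sub>R) t ` K"
      by blast
    show "(*\<^sub>R) t ` K + (*\<^sub>R) \<epsilon> ` M - (*\<^sub>R) t ` K \<in> sets ?\<mu>"
      unfolding sets using tK compact_plus_scaleR[OF tK M(1)]
      by (intro sets.Diff borel_compact)
  qed
  finally show "exp (- \<phi> (r * (t + d))) * (real ?n * t ^ (?n - 1) * d * measure lborel D) * \<epsilon>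
      \<le> measure ?\<mu> ((*\<^sub>R) t ` K + (*\<^sub>R) \<epsilon> ` M - (*\<^sub>R) t ` K)"
    by (simp add: algebra_simps)
qed (use M in auto)

section \<open>Comparison of the two mixed measures for large t\<close>

lemma dilate_subset_of_mixed_measure_le:
  fixes L K M :: "'a::euclidean_space set"
  assumes L: "compact L" "convex L" "0 \<in> interior L"
    and mono: "mono_on {0..} \<phi>" and nc: "\<not> \<phi> constant_on {0..}" and cvx: "convex_on {0..} \<phi>"
    and int: "integrable lborel (\<lambda>x. exp (- \<phi> (gauge_norm L x)))"
    and K: "compact K" "convex K" "0 \<in> interior K"
    and M: "compact M" "0 \<in> interior M"
    and R: "R > 0"
    and ev: "\<forall>\<^sub>F t in at_top.
      mixed_measure (gauge_measure \<phi> L) ((*\<^sub>R) t ` K) M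
        \<le> mixed_measure (gauge_measure \<phi> L) ((*\<^sub>R) (t * R) ` L) M"
  shows "(*\<^sub>R) R ` L \<subseteq> K"
proof (rule ccontr)
  assume nsub: "\<not> (*\<^sub>R) R ` L \<subseteq> K"
  let ?n = "DIM('a)"
  have K_closed: "closed K"
    using K(1) by (rule compact_imp_closed)
  obtain r U where r: "0 < r" "r < R"
    and U: "open U" "U \<noteq> {}" "U \<inter> K = {}" "U \<subseteq> (*\<^sub>R) r ` L"
    using open_outside_of_not_subset[OF L K_closed R nsub] by metis
  obtain D where D: "D \<in> sets borel" "bounded D" "measure lborel D > 0"
    "\<And>s t. 0 < s \<Longrightarrow> s \<le> t \<Longrightarrow> (*\<^sub>R) s ` D \<subseteq> (*\<^sub>R) t ` D"
    "\<And>s t. 0 < s \<Longrightarrow> s \<le> t \<Longrightarrow> (*\<^sub>R) t ` D - (*\<^sub>R) s ` D \<subseteq> (*\<^sub>R) t ` K - (*\<^sub>R) s ` K"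
    and D_cone: "\<And>t x. 0 < t \<Longrightarrow> x \<in> (*\<^sub>R) t ` D \<Longrightarrow> \<exists>l. 0 < l \<and> l < t \<and> x \<in> (*\<^sub>R) l ` U"
    using cone_section[OF K U(1-3)] by metis
  \<comment> \<open>A point of t D is l u with l < t and u in \<open>U\<close>, hence in r L; so it
    lies in (r l) L.\<close>
  have D_gauge: "gauge_norm L x \<le> r * t" if t: "0 < t" and x: "x \<in> (*\<^sub>R) t ` D" for t x
  proof -
    obtain l where l: "0 < l" "l < t" "x \<in> (*\<^sub>R) l ` U"
      using D_cone[OF t x] by blast
    then obtain z where "z \<in> L" "x = (r * l) *\<^sub>R z"
      using U(4) by (force simp: mult.commute)
    then have "gauge_norm L x \<le> r * l"
      using r l by (intro gauge_norm_le) auto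
    also have "\<dots> \<le> r * t"
      using r l by (intro mult_left_mono) auto
    finally show ?thesis .
  qed
  have M0: "0 \<in> M"
    using M(2) interior_subset by blast
  obtain c where c: "c > 0" "M \<subseteq> (*\<^sub>R) c ` L"
    using bounded_subset_scaleR_image[OF L(3) compact_imp_bounded[OF M(1)]] by blast
  obtain e where e: "e > 0" "K \<subseteq> (*\<^sub>R) e ` M"
    using bounded_subset_scaleR_image[OF M(2) compact_imp_bounded[OF K(1)]] by blast
  define d where "d = 1 / e"
  have d: "d > 0" "(*\<^sub>R) d ` K \<subseteq> M"
    using e by (force simp: d_def)+
  obtain m b where m: "m > 0" "b \<ge> 0"
    "\<And>u v. b \<le> u \<Longrightarrow> u \<le> v \<Longrightarrow> m * (v - u) \<le> \<phi> v - \<phi> u"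
    using convex_mono_linear_growth[OF mono nc cvx] by blast
  \<comment> \<open>\<open>Q\<close> and \<open>P\<close> are what remains of the upper and lower
    bounds once the exponentials and the common factor n t^(n-1) are split off.\<close>
  define Q where "Q = c * (R + c) ^ (?n - 1) * measure lborel L"
  define P where "P = d * measure lborel D"
  have P: "P > 0"
    using d D by (simp add: P_def)
  have bound: "P * m * (t * R - r * (t + d)) \<le> Q"
    if le: "mixed_measure (gauge_measure \<phi> L) ((*\<^sub>R) t ` K) M
        \<le> mixed_measure (gauge_measure \<phi> L) ((*\<^sub>R) (t * R) ` L) M"
      and t: "t \<ge> 1" "b \<le> r * (t + d)" "r * (t + d) \<le> t * R" for t
  proof -
    let ?w = "real ?n * t ^ (?n - 1)"
    have w: "?w > 0"
      using t by simp
    have "ereal (exp (- \<phi> (r * (t + d))) * (?w * d * measure lborel D))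
        \<le> mixed_measure (gauge_measure \<phi> L) ((*\<^sub>R) t ` K) M"
      using t D D_gauge d M M0 K L r int mono by (intro mixed_measure_gauge_ge) auto
    also note le
    also have "mixed_measure (gauge_measure \<phi> L) ((*\<^sub>R) (t * R) ` L) M
        \<le> ereal (exp (- \<phi> (t * R)) * (real ?n * (t * R + c) ^ (?n - 1) * c * measure lborel L))"
      using t R c M M0 L int mono by (intro mixed_measure_gauge_body_le) auto
    finally have 1: "exp (- \<phi> (r * (t + d))) * (?w * P)
        \<le> exp (- \<phi> (t * R)) * (real ?n * (t * R + c) ^ (?n - 1) * c * measure lborel L)"
      by (simp add: P_def mult.assoc)
    \<comment> \<open>t >= 1 gives t R + c <= t (R + c), so the upper bound carries the same power
      of t as the lower one.\<close>
    have "(t * R + c) ^ (?n - 1) \<le> (t * (R + c)) ^ (?n - 1)"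
      using t R c by (intro power_mono) (auto simp: algebra_simps)
    then have "real ?n * (t * R + c) ^ (?n - 1) * c * measure lborel L
        \<le> real ?n * (t * (R + c)) ^ (?n - 1) * c * measure lborel L"
      using c by (intro mult_right_mono mult_left_mono) auto
    also have "\<dots> = ?w * Q"
      by (simp add: Q_def power_mult_distrib)
    finally have "exp (- \<phi> (t * R)) * (real ?n * (t * R + c) ^ (?n - 1) * c * measure lborel L)
        \<le> exp (- \<phi> (t * R)) * (?w * Q)"
      by (intro mult_left_mono) auto
    with 1 have "exp (- \<phi> (r * (t + d))) * (?w * P) \<le> exp (- \<phi> (t * R)) * (?w * Q)"
      by (rule order_trans)
    then have "?w * (exp (- \<phi> (r * (t + d))) * P) \<le> ?w * (exp (- \<phi> (t * R)) * Q)"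
      by (simp only: mult.left_commute)
    then have "exp (- \<phi> (r * (t + d))) * P \<le> exp (- \<phi> (t * R)) * Q"
      using w by (simp only: mult_le_cancel_left_pos)
    then have "exp (\<phi> (t * R)) * (exp (- \<phi> (r * (t + d))) * P)
        \<le> exp (\<phi> (t * R)) * (exp (- \<phi> (t * R)) * Q)"
      by (intro mult_left_mono) auto
    then have 2: "P * exp (\<phi> (t * R) - \<phi> (r * (t + d))) \<le> Q"
      by (simp add: exp_minus exp_diff field_simps)
    have "m * (t * R - r * (t + d)) \<le> \<phi> (t * R) - \<phi> (r * (t + d))"
      using m(3) t by blast
    \<comment> \<open>The crude bound y <= exp y is enough: a left side growing linearly in t
      already contradicts the constant \<open>Q\<close>.\<close>
    also have "\<dots> \<le> exp (\<phi> (t * R) - \<phi> (r * (t + d)))"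
      using exp_ge_add_one_self[of "\<phi> (t * R) - \<phi> (r * (t + d))"] by linarith
    finally have "P * (m * (t * R - r * (t + d))) \<le> P * exp (\<phi> (t * R) - \<phi> (r * (t + d)))"
      using P by (intro mult_left_mono) auto
    with 2 show ?thesis
      by (simp add: mult.assoc)
  qed
  have lim: "filterlim (\<lambda>t. t * R - r * (t + d)) at_top at_top"
    using r by real_asymp
  \<comment> \<open>The threshold Q / (P m) + 1 makes the left side of \<open>bound\<close> exceed
    \<open>Q\<close> by at least P m; the maximum with 0 secures r (t + d) <= t R.\<close>
  have "\<forall>\<^sub>F t in at_top. t * R - r * (t + d) \<ge> max 0 (Q / (P * m) + 1)"
    using lim by (simp only: filterlim_at_top)
  moreover have "\<forall>\<^sub>F t in at_top. b \<le> r * (t + d)"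
    using r by real_asymp
  ultimately have "\<forall>\<^sub>F t::real in at_top. False"
    using ev eventually_ge_at_top[of 1]
  proof eventually_elim
    case (elim t)
    have "P * m * (Q / (P * m) + 1) \<le> P * m * (t * R - r * (t + d))"
      using elim(1) P m by (intro mult_left_mono) auto
    also have "\<dots> \<le> Q"
      using elim by (intro bound) auto
    finally have "P * m * (Q / (P * m)) + P * m \<le> Q"
      by (simp only: distrib_left mult_1_right)
    moreover have "P * m * (Q / (P * m)) = Q" "P * m > 0"
      using P m by auto
    ultimately show False
      by linarith
  qed
  then show False
    by simp
qed

theorem theorem4p2:
  fixes L K M :: "(real ^ 'n) set"
    and \<phi> :: "real \<Rightarrow> real"
    and R :: real
  assumes "CARD('n) \<ge> 2"
    and "convex_body L" and "0 \<in> interior L"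
    and "\<And>s. 0 \<le> s \<Longrightarrow> 0 \<le> \<phi> s"
    and "mono_on {0..} \<phi>"
    and "\<not> \<phi> constant_on {0..}"
    and "convex_on {0..} \<phi>"
    and "(\<integral>x. exp (- \<phi> (gauge_norm L x)) \<partial>lborel) = 1"
    and "convex_body K" and "0 \<in> interior K"
    and "convex_body M" and "0 \<in> interior M"
    and "R > 0"
    and "eventually (\<lambda>t::real.
           mixed_measure (gauge_measure \<phi> L) ((*\<^sub>R) (t * R) ` L) M
             \<ge> mixed_measure (gauge_measure \<phi> L) ((*\<^sub>R) t ` K) M) at_top"
  shows "(*\<^sub>R) R ` L \<subseteq> K"
proof (rule dilate_subset_of_mixed_measure_le[of L \<phi> K M R])
  \<comment> \<open>The Bochner integral of a nonintegrable function is 0 by convention, so the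
    value 1 forces integrability.\<close>
  show "integrable lborel (\<lambda>x. exp (- \<phi> (gauge_norm L x)))"
    using assms(8) by (metis not_integrable_integral_eq zero_neq_one)
qed (use assms in \<open>auto simp: convex_body_def\<close>)

end
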